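(* For every integer $l \geq 4$, $\sigma^{-}(P(2l,2)) = 6$.
   Context: For $n \geq 3$, $k \geq 1$ with $2k<n$, the generalized Petersen graph $P(n,k)$ has vertex set $\{u_i, v_i : i=0,1,\dots,n-1\}$ and edge set $\{u_iu_{i+1},\ u_iv_i,\ v_iv_{i+k} : i=0,\dots,n-1\}$, subscripts read modulo $n$. For a simple connected graph $G$ of order $N$, the \textbf{rna} number $\sigma^{-}(G)$ is the minimum, over all bijections $f: V(G)\to\{1,2,\dots,N\}$, of the number of edges $uv$ of $G$ such that $f(u)$ and $f(v)$ have different parity. *)

theory Defs
  imports Main
begin

text \<open>A finite simple graph is a pair \<open>(V, E)\<close> of a finite vertex set and a set of two-element
  subsets of it; an edge \<open>uv\<close> is the unordered pair \<open>{u, v}\<close>.\<close>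

type_synonym 'a ugraph = "'a set \<times> 'a set set"

definition simple_graph :: "'a ugraph \<Rightarrow> bool" where
  "simple_graph G \<longleftrightarrow>
     finite (fst G) \<and> (\<forall>e \<in> snd G. \<exists>u \<in> fst G. \<exists>v \<in> fst G. u \<noteq> v \<and> e = {u, v})"

definition connected_graph :: "'a ugraph \<Rightarrow> bool" where
  "connected_graph G \<longleftrightarrow>
     fst G \<noteq> {} \<and> (\<forall>x \<in> fst G. \<forall>y \<in> fst G. (x, y) \<in> {(u, v). {u, v} \<in> snd G}\<^sup>*)"

definition labellings :: "'a ugraph \<Rightarrow> ('a \<Rightarrow> nat) set" where
  "labellings G = {f. bij_betw f (fst G) {1..card (fst G)}}"

definition parity_cut :: "'a ugraph \<Rightarrow> ('a \<Rightarrow> nat) \<Rightarrow> 'a set set" where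
  "parity_cut G f = {e \<in> snd G. \<exists>u v. e = {u, v} \<and> even (f u) \<noteq> even (f v)}"

definition rna_number :: "'a ugraph \<Rightarrow> nat" where
  "rna_number G = Min {card (parity_cut G f) | f. f \<in> labellings G}"

datatype gp_vertex = U nat | V nat

text \<open>Meaningful for \<open>n \<ge> 3\<close>, \<open>k \<ge> 1\<close> and \<open>2 * k < n\<close>.\<close>

definition gen_petersen :: "nat \<Rightarrow> nat \<Rightarrow> gp_vertex ugraph" where
  "gen_petersen n k =
     (U ` {..<n} \<union> V ` {..<n},
      {{U i, U ((i + 1) mod n)} | i. i < n} \<union>
      {{U i, V i} | i. i < n} \<union>
      {{V i, V ((i + k) mod n)} | i. i < n})"

text \<open>The minimum ranges over a finite nonempty set, and the graphs in question are simple,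
  connected and of order \<open>2 * n\<close>, as the definition of the rna number presupposes.\<close>

lemma rna_number_attained:
  assumes "simple_graph G"
  shows "\<exists>f \<in> labellings G. rna_number G = card (parity_cut G f)"
    and "\<And>f. f \<in> labellings G \<Longrightarrow> rna_number G \<le> card (parity_cut G f)"
proof -
  let ?S = "{card (parity_cut G f) | f. f \<in> labellings G}"
  have fV: "finite (fst G)" using assms by (simp add: simple_graph_def)
  have "snd G \<subseteq> Pow (fst G)" using assms by (auto simp: simple_graph_def)
  then have fE: "finite (snd G)" using fV by (meson finite_Pow_iff finite_subset)
  have "?S \<subseteq> {..card (snd G)}"
    by (auto simp: parity_cut_def intro!: card_mono fE)
  then have fin: "finite ?S" using finite_subset by blast
  have "\<exists>f. bij_betw f (fst G) {1..card (fst G)}"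
    using fV by (intro finite_same_card_bij) auto
  then have ne: "?S \<noteq> {}" by (auto simp: labellings_def)
  show "\<exists>f \<in> labellings G. rna_number G = card (parity_cut G f)"
    using Min_in[OF fin ne] unfolding rna_number_def by blast
  show "rna_number G \<le> card (parity_cut G f)" if "f \<in> labellings G" for f
    unfolding rna_number_def using that by (intro Min_le fin) blast
qed

lemma gp_shift_neq:
  fixes i k n :: nat
  assumes "i < n" "0 < k" "k < n"
  shows "(i + k) mod n \<noteq> i"
proof (cases "i + k < n")
  case False
  then have "(i + k) mod n = i + k - n" using assms by (simp add: le_mod_geq)
  then show ?thesis using assms False by simp
qed (use assms in simp)

lemma simple_graph_gen_petersen:
  assumes "3 \<le> n" "1 \<le> k" "2 * k < n"
  shows "simple_graph (gen_petersen n k)"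
proof -
  have neqU: "i \<noteq> Suc i mod n" if "i < n" for i
    using gp_shift_neq[of i n 1] that assms by auto
  have neqV: "i \<noteq> (i + k) mod n" if "i < n" for i
    using gp_shift_neq[of i n k] that assms by auto
  have "\<exists>u \<in> fst (gen_petersen n k). \<exists>v \<in> fst (gen_petersen n k). u \<noteq> v \<and> e = {u, v}"
    if e: "e \<in> snd (gen_petersen n k)" for e
  proof -
    consider i where "i < n" "e = {U i, U (Suc i mod n)}" | i where "i < n" "e = {U i, V i}"
      | i where "i < n" "e = {V i, V ((i + k) mod n)}"
      using e by (auto simp: gen_petersen_def)
    then show ?thesis
    proof cases
      case 1
      then show ?thesis using neqU[of i] assms
        by (intro bexI[of _ "U i"] bexI[of _ "U (Suc i mod n)"]) (auto simp: gen_petersen_def)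
    next
      case 2
      then show ?thesis
        by (intro bexI[of _ "U i"] bexI[of _ "V i"]) (auto simp: gen_petersen_def)
    next
      case 3
      then show ?thesis using neqV[of i] assms
        by (intro bexI[of _ "V i"] bexI[of _ "V ((i + k) mod n)"]) (auto simp: gen_petersen_def)
    qed
  qed
  then show ?thesis by (auto simp: simple_graph_def gen_petersen_def)
qed

lemma connected_graph_gen_petersen:
  assumes "0 < n"
  shows "connected_graph (gen_petersen n k)"
proof -
  define R where "R = {(u, v). {u, v} \<in> snd (gen_petersen n k)}"
  have "sym R" unfolding R_def sym_def by (simp add: insert_commute)
  then have sym: "sym (R\<^sup>*)" by (rule sym_rtrancl)
  have stepU: "(U i, U (Suc i)) \<in> R" if "Suc i < n" for i
  proof -
    have "{U i, U (Suc i)} = {U i, U ((i + 1) mod n)} \<and> i < n" using that by simp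
    then show ?thesis unfolding R_def gen_petersen_def by simp blast
  qed
  have stepV: "(U i, V i) \<in> R" if "i < n" for i
    unfolding R_def gen_petersen_def using that by simp blast
  have U: "(U 0, U i) \<in> R\<^sup>*" if "i < n" for i
    using that
  proof (induction i)
    case (Suc i)
    then show ?case using stepU[of i] by (meson Suc_lessD rtrancl.rtrancl_into_rtrancl)
  qed simp
  have V: "(U 0, V i) \<in> R\<^sup>*" if "i < n" for i
    using U[OF that] stepV[OF that] by (rule rtrancl.rtrancl_into_rtrancl)
  have "(U 0, x) \<in> R\<^sup>*" if "x \<in> fst (gen_petersen n k)" for x
    using that U V by (auto simp: gen_petersen_def)
  then have "\<forall>x \<in> fst (gen_petersen n k). \<forall>y \<in> fst (gen_petersen n k). (x, y) \<in> R\<^sup>*"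
    using sym by (meson rtrancl_trans symD)
  moreover have "U 0 \<in> fst (gen_petersen n k)" using assms by (simp add: gen_petersen_def)
  ultimately show ?thesis unfolding connected_graph_def R_def by blast
qed

lemma card_gen_petersen: "card (fst (gen_petersen n k)) = 2 * n"
  by (simp add: gen_petersen_def, subst card_Un_disjoint) (auto simp: card_image inj_on_def)

end

theory Submission
  imports Defs
begin

text \<open>For \<open>n = 2 * l\<close> the graph consists of an outer cycle, two inner cycles through the
  vertices \<open>V i\<close> with \<open>i\<close> even and with \<open>i\<close> odd, and the spokes. A labelling makes exactly half
  of the \<open>4 * l\<close> vertices even, and a cycle that contains both parities has at least two cut edges;
  so six cut edges arise unless one of the cycles is monochromatic. In that case, let \<open>X\<close>, \<open>Y\<close>,
  \<open>E\<close>, \<open>O\<close> count the even labels on the outer and inner vertices with even and odd index. At least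
  \<open>2\<bar>X - Y\<bar>\<close> outer edges and \<open>\<bar>X - E\<bar> + \<bar>Y - O\<bar>\<close> spokes are cut, which with \<open>X + Y + E + O = 2 * l\<close>
  again gives six. Equality holds when the even labels fill \<open>l\<close> consecutive columns.\<close>

abbreviation count_below :: "nat \<Rightarrow> (nat \<Rightarrow> bool) \<Rightarrow> nat" where
  "count_below l P \<equiv> card {j. j < l \<and> P j}"

lemma count_below_le: "count_below l P \<le> l"
  using card_mono[of "{..<l}" "{j. j < l \<and> P j}"] by auto

lemma count_below_eq_0_iff: "count_below l P = 0 \<longleftrightarrow> (\<forall>j<l. \<not> P j)"
  by auto

lemma count_below_eq_iff: "count_below l P = l \<longleftrightarrow> (\<forall>j<l. P j)"
proof
  assume "count_below l P = l"
  then have "{j. j < l \<and> P j} = {..<l}"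
    by (intro card_subset_eq) auto
  then show "\<forall>j<l. P j" by auto
next
  assume "\<forall>j<l. P j"
  then have "{j. j < l \<and> P j} = {..<l}" by auto
  then show "count_below l P = l" by simp
qed

lemma count_below_le_add_neq:
  "count_below l P \<le> count_below l Q + count_below l (\<lambda>j. P j \<noteq> Q j)"
proof -
  have "count_below l P \<le> card ({j. j < l \<and> Q j} \<union> {j. j < l \<and> P j \<noteq> Q j})"
    by (intro card_mono) auto
  also have "\<dots> \<le> count_below l Q + count_below l (\<lambda>j. P j \<noteq> Q j)"
    by (rule card_Un_le)
  finally show ?thesis .
qed

lemma count_below_neq_commute:
  "count_below l (\<lambda>j. P j \<noteq> Q j) = count_below l (\<lambda>j. Q j \<noteq> P j)"
  by (rule arg_cong[where f = card]) auto

lemma count_below_double: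
  "count_below (2 * l) P = count_below l (\<lambda>j. P (2 * j)) + count_below l (\<lambda>j. P (2 * j + 1))"
proof -
  have "{i. i < 2 * l \<and> P i} =
    (\<lambda>j. 2 * j) ` {j. j < l \<and> P (2 * j)} \<union> (\<lambda>j. 2 * j + 1) ` {j. j < l \<and> P (2 * j + 1)}"
    (is "_ = ?A \<union> ?B")
  proof (intro equalityI subsetI)
    fix i assume i: "i \<in> {i. i < 2 * l \<and> P i}"
    show "i \<in> ?A \<union> ?B"
    proof (cases "even i")
      case True
      then obtain j where "i = 2 * j" by (elim evenE)
      then show ?thesis using i by auto
    next
      case False
      then obtain j where "i = 2 * j + 1" by (elim oddE)
      then show ?thesis using i by auto
    qed
  qed auto
  moreover have "?A \<inter> ?B = {}" by auto presburger
  ultimately show ?thesis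
    by (simp add: card_Un_disjoint card_image inj_on_def)
qed

lemma bij_betw_Suc_mod:
  assumes "0 < l"
  shows "bij_betw (\<lambda>j. Suc j mod l) {..<l} {..<l}"
proof -
  have "inj_on (\<lambda>j. Suc j mod l) {..<l}"
    by (auto simp: inj_on_def mod_Suc split: if_splits)
  moreover have "(\<lambda>j. Suc j mod l) ` {..<l} \<subseteq> {..<l}" using assms by auto
  ultimately show ?thesis
    by (simp add: bij_betw_def endo_inj_surj)
qed

lemma count_below_rotate:
  assumes "0 < l"
  shows "count_below l (\<lambda>j. P (Suc j mod l)) = count_below l P"
proof (rule bij_betw_same_card)
  have b: "bij_betw (\<lambda>j. Suc j mod l) {..<l} {..<l}"
    using assms by (rule bij_betw_Suc_mod)
  have "{j. j < l \<and> P j} \<subseteq> (\<lambda>j. Suc j mod l) ` {j. j < l \<and> P (Suc j mod l)}"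
  proof
    fix k assume k: "k \<in> {j. j < l \<and> P j}"
    then obtain j where "j < l" "k = Suc j mod l"
      using bij_betw_imp_surj_on[OF b] by (auto simp: set_eq_iff image_iff)
    then show "k \<in> (\<lambda>j. Suc j mod l) ` {j. j < l \<and> P (Suc j mod l)}" using k by auto
  qed
  then show "bij_betw (\<lambda>j. Suc j mod l) {j. j < l \<and> P (Suc j mod l)} {j. j < l \<and> P j}"
    using bij_betw_imp_inj_on[OF b] assms
    by (auto simp: bij_betw_def intro: inj_on_subset)
qed

lemma cyclic_descent:
  fixes P :: "nat \<Rightarrow> bool"
  assumes "i < l" "k < l" "P i" "\<not> P k"
  shows "\<exists>j<l. P j \<and> \<not> P (Suc j mod l)"
proof (rule ccontr)
  assume *: "\<not> ?thesis"
  have "P ((i + m) mod l)" for m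
  proof (induction m)
    case (Suc m)
    have "(i + m) mod l < l" using assms by simp
    then have "P (Suc ((i + m) mod l) mod l)" using Suc * by blast
    then show ?case by (simp add: mod_Suc_eq)
  qed (use assms in simp)
  from this[of "l + k - i"] show False using assms by simp
qed

lemma cyclic_changes_ge_2:
  assumes "0 < count_below l P" "count_below l P < l"
  shows "2 \<le> count_below l (\<lambda>j. P j \<noteq> P (Suc j mod l))"
proof -
  have "\<exists>i<l. P i" "\<exists>k<l. \<not> P k"
    using assms count_below_eq_0_iff[of l P] count_below_eq_iff[of l P] by (metis less_irrefl)+
  then obtain i k where ik: "i < l" "P i" "k < l" "\<not> P k" by blast
  obtain a where a: "a < l" "P a" "\<not> P (Suc a mod l)"
    using cyclic_descent[of i l k P] ik by blast
  obtain b where b: "b < l" "\<not> P b" "P (Suc b mod l)"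
    using cyclic_descent[of k l i "\<lambda>j. \<not> P j"] ik by blast
  have "card {a, b} \<le> count_below l (\<lambda>j. P j \<noteq> P (Suc j mod l))"
    using a b by (intro card_mono) auto
  moreover have "a \<noteq> b" using a b by auto
  ultimately show ?thesis by simp
qed

lemma cut_counts_ge_6:
  fixes X Y E Q out s1 s2 c1 c2 l :: nat
  assumes l: "4 \<le> l" and sum: "X + Y + E + Q = 2 * l"
    and le: "X \<le> l" "Y \<le> l" "E \<le> l" "Q \<le> l"
    and xy: "2 * X \<le> 2 * Y + out" "2 * Y \<le> 2 * X + out"
    and xe: "X \<le> E + s1" "E \<le> X + s1" and yq: "Y \<le> Q + s2" "Q \<le> Y + s2"
    and out: "0 < X + Y \<Longrightarrow> X + Y < 2 * l \<Longrightarrow> 2 \<le> out"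
    and c1: "0 < E \<Longrightarrow> E < l \<Longrightarrow> 2 \<le> c1" and c2: "0 < Q \<Longrightarrow> Q < l \<Longrightarrow> 2 \<le> c2"
  shows "6 \<le> out + (s1 + s2) + (c1 + c2)"
proof -
  consider (mono) "X + Y = 0 \<or> X + Y = 2 * l" | (mixed) "2 \<le> out"
    using out le by linarith
  then show ?thesis
  proof cases
    case mono
    then show ?thesis
    proof
      assume "X + Y = 0"
      then show ?thesis using sum l xe(2) yq(2) by linarith
    next
      assume "X + Y = 2 * l"
      then show ?thesis using sum l xe(1) yq(1) by linarith
    qed
  next
    case mixed
    have "E = 0 \<or> E = l \<or> 2 \<le> c1" using c1 le by linarith
    moreover have "Q = 0 \<or> Q = l \<or> 2 \<le> c2" using c2 le by linarith
    ultimately consider "E = 0" "Q = 0" | "E = 0" "Q = l" | "E = 0" "2 \<le> c2"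
      | "E = l" "Q = 0" | "E = l" "Q = l" | "E = l" "2 \<le> c2"
      | "2 \<le> c1" "Q = 0" | "2 \<le> c1" "Q = l" | "2 \<le> c1" "2 \<le> c2"
      by blast
    then show ?thesis
    proof cases
      case 1
      then show ?thesis using sum l xe(1) yq(1) by linarith
    next
      case 2
      then show ?thesis using sum l xe(1) yq(2) xy(2) mixed by (cases "X \<le> 1") linarith+
    next
      case 3
      then show ?thesis using sum l le(4) xe(1) xy(2) mixed by (cases "X \<le> 1") linarith+
    next
      case 4
      then show ?thesis using sum l xe(2) yq(1) xy(1) mixed by (cases "Y \<le> 1") linarith+
    next
      case 5
      then show ?thesis using sum l xe(2) yq(2) by linarith
    next
      case 6
      then show ?thesis using sum l xe(2) xy(1) mixed by (cases "X + 2 \<le> l") linarith+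
    next
      case 7
      then show ?thesis using sum l le(3) yq(1) xy(1) mixed by (cases "Y \<le> 1") linarith+
    next
      case 8
      then show ?thesis using sum l yq(2) xy(2) mixed by (cases "Y + 2 \<le> l") linarith+
    next
      case 9
      then show ?thesis using mixed by linarith
    qed
  qed
qed

lemma balanced_colouring_cut_ge_6:
  fixes u v :: "nat \<Rightarrow> bool"
  assumes l: "4 \<le> l" and n: "n = 2 * l"
    and bal: "count_below n u + count_below n v = n"
  shows "6 \<le> count_below n (\<lambda>i. u i \<noteq> u ((i + 1) mod n)) + count_below n (\<lambda>i. u i \<noteq> v i) +
    count_below n (\<lambda>i. v i \<noteq> v ((i + 2) mod n))"
proof -
  define x y e w where "x = (\<lambda>j. u (2 * j))" and "y = (\<lambda>j. u (2 * j + 1))"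
    and "e = (\<lambda>j. v (2 * j))" and "w = (\<lambda>j. v (2 * j + 1))"
  let ?X = "count_below l x" and ?Y = "count_below l y"
    and ?E = "count_below l e" and ?O = "count_below l w"
  let ?out = "count_below n (\<lambda>i. u i \<noteq> u ((i + 1) mod n))"
    and ?spoke = "count_below n (\<lambda>i. u i \<noteq> v i)"
    and ?inn = "count_below n (\<lambda>i. v i \<noteq> v ((i + 2) mod n))"
  have odd_mod: "Suc (2 * j) mod (2 * l) = Suc (2 * j)" if "j < l" for j
    using that by simp
  have even_mod: "Suc (Suc (2 * j)) mod (2 * l) = 2 * (Suc j mod l)" for j
    using mult_mod_right[of 2 "Suc j" l] by simp
  have odd_mod': "Suc (Suc (Suc (2 * j))) mod (2 * l) = Suc (2 * (Suc j mod l))" for j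
  proof -
    have "Suc (2 * m) \<noteq> 2 * l" for m by presburger
    then show ?thesis by (simp only: mod_Suc[of "Suc (Suc (2 * j))"] even_mod if_False)
  qed
  have cu: "count_below n u = ?X + ?Y" and cv: "count_below n v = ?E + ?O"
    unfolding n x_def y_def e_def w_def by (fact count_below_double)+
  have out: "?out = count_below l (\<lambda>j. x j \<noteq> y j) + count_below l (\<lambda>j. y j \<noteq> x (Suc j mod l))"
    unfolding n count_below_double x_def y_def
    by (intro arg_cong2[where f = "(+)"] arg_cong[where f = card])
      (auto simp: odd_mod even_mod)
  have spoke: "?spoke = count_below l (\<lambda>j. x j \<noteq> e j) + count_below l (\<lambda>j. y j \<noteq> w j)"
    unfolding n count_below_double x_def y_def e_def w_def by simp
  have inn: "?inn = count_below l (\<lambda>j. e j \<noteq> e (Suc j mod l)) +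
      count_below l (\<lambda>j. w j \<noteq> w (Suc j mod l))"
    unfolding n count_below_double e_def w_def
    by (intro arg_cong2[where f = "(+)"] arg_cong[where f = card])
      (auto simp: even_mod odd_mod')
  have le: "?X \<le> l" "?Y \<le> l" "?E \<le> l" "?O \<le> l"
    by (rule count_below_le)+
  have rot: "count_below l (\<lambda>j. x (Suc j mod l)) = ?X"
    using l by (intro count_below_rotate) auto
  have xy: "?X \<le> ?Y + count_below l (\<lambda>j. x j \<noteq> y j)" "?Y \<le> ?X + count_below l (\<lambda>j. x j \<noteq> y j)"
    using count_below_le_add_neq[of l x y] count_below_le_add_neq[of l y x]
    by (simp_all only: count_below_neq_commute[of l y x])
  have yx: "?X \<le> ?Y + count_below l (\<lambda>j. y j \<noteq> x (Suc j mod l))"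
    "?Y \<le> ?X + count_below l (\<lambda>j. y j \<noteq> x (Suc j mod l))"
    using count_below_le_add_neq[of l y "\<lambda>j. x (Suc j mod l)"]
      count_below_le_add_neq[of l "\<lambda>j. x (Suc j mod l)" y]
    by (simp_all only: count_below_neq_commute[of l "\<lambda>j. x (Suc j mod l)" y] rot)
  have xe: "?X \<le> ?E + count_below l (\<lambda>j. x j \<noteq> e j)" "?E \<le> ?X + count_below l (\<lambda>j. x j \<noteq> e j)"
    using count_below_le_add_neq[of l x e] count_below_le_add_neq[of l e x]
    by (simp_all only: count_below_neq_commute[of l e x])
  have yo: "?Y \<le> ?O + count_below l (\<lambda>j. y j \<noteq> w j)" "?O \<le> ?Y + count_below l (\<lambda>j. y j \<noteq> w j)"
    using count_below_le_add_neq[of l y w] count_below_le_add_neq[of l w y]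
    by (simp_all only: count_below_neq_commute[of l w y])
  have out2: "2 \<le> ?out" if "0 < ?X + ?Y" "?X + ?Y < 2 * l"
    using cyclic_changes_ge_2[of n u] that cu n by simp
  have e2: "2 \<le> count_below l (\<lambda>j. e j \<noteq> e (Suc j mod l))" if "0 < ?E" "?E < l"
    using that by (rule cyclic_changes_ge_2)
  have o2: "2 \<le> count_below l (\<lambda>j. w j \<noteq> w (Suc j mod l))" if "0 < ?O" "?O < l"
    using that by (rule cyclic_changes_ge_2)
  have sum: "?X + ?Y + ?E + ?O = 2 * l" using bal cu cv n by simp
  have out_xy: "2 * ?X \<le> 2 * ?Y + ?out" "2 * ?Y \<le> 2 * ?X + ?out"
    using xy yx out by linarith+
  show ?thesis
    unfolding spoke inn
    by (rule cut_counts_ge_6[OF l sum le out_xy xe yo]) (fact out2 e2 o2)+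
qed

lemma inj_on_shift_edges:
  fixes C :: "nat \<Rightarrow> 'a"
  assumes "inj C" "0 < k" "2 * k < n"
  shows "inj_on (\<lambda>i. {C i, C ((i + k) mod n)}) {..<n}"
proof (rule inj_onI)
  fix i j :: nat
  assume ij: "i \<in> {..<n}" "j \<in> {..<n}" "{C i, C ((i + k) mod n)} = {C j, C ((j + k) mod n)}"
  show "i = j"
  proof (rule ccontr)
    assume "i \<noteq> j"
    then have "i = (j + k) mod n" "(i + k) mod n = j"
      using ij assms(1) by (auto simp: doubleton_eq_iff inj_eq)
    then have "(i + 2 * k) mod n = i"
      by (metis add.assoc mod_add_left_eq mult_2)
    then show False using gp_shift_neq[of i n "2 * k"] ij assms by auto
  qed
qed

lemma card_parity_cut_gen_petersen:
  assumes "0 < k" "2 * k < n" "2 < n"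
  shows "card (parity_cut (gen_petersen n k) f) =
    count_below n (\<lambda>i. even (f (U i)) \<noteq> even (f (U ((i + 1) mod n)))) +
    count_below n (\<lambda>i. even (f (U i)) \<noteq> even (f (V i))) +
    count_below n (\<lambda>i. even (f (V i)) \<noteq> even (f (V ((i + k) mod n))))"
    (is "_ = card ?A + card ?B + card ?C")
proof -
  let ?a = "\<lambda>i. {U i, U ((i + 1) mod n)}" and ?b = "\<lambda>i. {U i, V i}"
    and ?c = "\<lambda>i. {V i, V ((i + k) mod n)}"
  have cut: "(\<exists>u v. {s, t} = {u, v} \<and> even (f u) \<noteq> even (f v)) \<longleftrightarrow> even (f s) \<noteq> even (f t)" for s t
    by (auto simp: doubleton_eq_iff)
  have restrict: "{e \<in> g ` {..<n}. \<exists>u v. e = {u, v} \<and> even (f u) \<noteq> even (f v)} =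
      g ` {i. i < n \<and> (\<exists>u v. g i = {u, v} \<and> even (f u) \<noteq> even (f v))}" for g
    by blast
  have "snd (gen_petersen n k) = ?a ` {..<n} \<union> ?b ` {..<n} \<union> ?c ` {..<n}"
    by (simp add: gen_petersen_def setcompr_eq_image lessThan_def)
  then have "parity_cut (gen_petersen n k) f =
      {e \<in> ?a ` {..<n}. \<exists>u v. e = {u, v} \<and> even (f u) \<noteq> even (f v)} \<union>
      {e \<in> ?b ` {..<n}. \<exists>u v. e = {u, v} \<and> even (f u) \<noteq> even (f v)} \<union>
      {e \<in> ?c ` {..<n}. \<exists>u v. e = {u, v} \<and> even (f u) \<noteq> even (f v)}"
    unfolding parity_cut_def by (simp only: Un_iff conj_disj_distribR Collect_disj_eq)
  also have "\<dots> = ?a ` ?A \<union> ?b ` ?B \<union> ?c ` ?C"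
    by (simp only: restrict cut)
  finally have eq: "parity_cut (gen_petersen n k) f = ?a ` ?A \<union> ?b ` ?B \<union> ?c ` ?C" .
  have "inj_on ?a {..<n}" using assms inj_on_shift_edges[of U 1 n] by (simp add: inj_def)
  then have a: "card (?a ` ?A) = card ?A"
    by (intro card_image) (auto intro: inj_on_subset)
  have b: "card (?b ` ?B) = card ?B"
    by (intro card_image) (auto simp: inj_on_def doubleton_eq_iff)
  have "inj_on ?c {..<n}" using assms by (intro inj_on_shift_edges) (simp_all add: inj_def)
  then have c: "card (?c ` ?C) = card ?C"
    by (intro card_image) (auto intro: inj_on_subset)
  have "?a ` ?A \<inter> ?b ` ?B = {}" "(?a ` ?A \<union> ?b ` ?B) \<inter> ?c ` ?C = {}"
    by (auto simp: doubleton_eq_iff)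
  then show ?thesis unfolding eq a[symmetric] b[symmetric] c[symmetric]
    by (simp add: card_Un_disjoint)
qed

lemma card_even_upto: "card {m \<in> {1..2 * n}. even m} = n" for n :: nat
proof -
  have "{m \<in> {1..2 * n}. even m} = (\<lambda>j. 2 * j) ` {1..n}" by (auto elim!: evenE)
  then show ?thesis by (simp add: card_image inj_on_def)
qed

lemma labelling_balanced:
  assumes "f \<in> labellings (gen_petersen n k)"
  shows "count_below n (\<lambda>i. even (f (U i))) + count_below n (\<lambda>i. even (f (V i))) = n"
proof -
  let ?W = "U ` {..<n} \<union> V ` {..<n}"
  have bij: "bij_betw f ?W {1..2 * n}"
    using assms card_gen_petersen[of n k] by (simp add: labellings_def gen_petersen_def)
  have "bij_betw f {w \<in> ?W. even (f w)} {m \<in> {1..2 * n}. even m}"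
  proof (rule bij_betw_imageI)
    show "inj_on f {w \<in> ?W. even (f w)}"
      using bij_betw_imp_inj_on[OF bij] by (rule inj_on_subset) blast
    show "f ` {w \<in> ?W. even (f w)} = {m \<in> {1..2 * n}. even m}"
      unfolding bij_betw_imp_surj_on[OF bij, symmetric] by blast
  qed
  then have "card {w \<in> ?W. even (f w)} = n"
    by (rule bij_betw_same_card[THEN trans, OF _ card_even_upto])
  moreover have "{w \<in> ?W. even (f w)} =
      U ` {i. i < n \<and> even (f (U i))} \<union> V ` {i. i < n \<and> even (f (V i))}"
    by auto
  moreover have "card (U ` {i. i < n \<and> even (f (U i))} \<union> V ` {i. i < n \<and> even (f (V i))}) =
      count_below n (\<lambda>i. even (f (U i))) + count_below n (\<lambda>i. even (f (V i)))"
    by (subst card_Un_disjoint) (auto simp: card_image inj_on_def)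
  ultimately show ?thesis by simp
qed

fun half_labelling :: "nat \<Rightarrow> gp_vertex \<Rightarrow> nat" where
  "half_labelling l (U i) = (if i < l then 4 * i + 2 else 4 * (i - l) + 1)"
| "half_labelling l (V i) = (if i < l then 4 * i + 4 else 4 * (i - l) + 3)"

lemma even_half_labelling:
  "even (half_labelling l (U i)) \<longleftrightarrow> i < l" "even (half_labelling l (V i)) \<longleftrightarrow> i < l"
  by auto

lemma half_labelling_in_labellings:
  "half_labelling l \<in> labellings (gen_petersen (2 * l) k)"
proof -
  let ?W = "U ` {..<2 * l} \<union> V ` {..<2 * l}"
  have inj: "inj_on (half_labelling l) ?W"
    by (auto simp: inj_on_def split: if_splits; presburger)
  have "half_labelling l ` ?W = {1..4 * l}"
  proof (rule card_subset_eq)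
    show "half_labelling l ` ?W \<subseteq> {1..4 * l}" by auto
    show "card (half_labelling l ` ?W) = card {1..4 * l}"
      using card_image[OF inj] card_gen_petersen[of "2 * l" k] by (simp add: gen_petersen_def)
  qed simp
  then show ?thesis
    using inj card_gen_petersen[of "2 * l" k]
    by (simp add: labellings_def bij_betw_def gen_petersen_def)
qed

lemma card_parity_cut_half_labelling:
  assumes "4 \<le> l"
  shows "card (parity_cut (gen_petersen (2 * l) 2) (half_labelling l)) \<le> 6"
proof -
  have mod1: "(i + 1) mod (2 * l) = (if i + 1 < 2 * l then i + 1 else i + 1 - 2 * l)"
    and mod2: "(i + 2) mod (2 * l) = (if i + 2 < 2 * l then i + 2 else i + 2 - 2 * l)"
    if "i < 2 * l" for i
    using that assms by (auto simp: le_mod_geq)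
  have "count_below (2 * l) (\<lambda>i. (i < l) \<noteq> ((i + 1) mod (2 * l) < l)) \<le> card {l - 1, 2 * l - 1}"
    by (intro card_mono) (auto simp: mod1 split: if_splits)
  moreover have "card {l - 1, 2 * l - 1} \<le> 2" by (simp add: card_insert_if)
  moreover have "count_below (2 * l) (\<lambda>i. (i < l) \<noteq> ((i + 2) mod (2 * l) < l)) \<le>
      card {l - 1, l - 2, 2 * l - 1, 2 * l - 2}"
    by (intro card_mono) (auto simp: mod2 split: if_splits)
  moreover have "card {l - 1, l - 2, 2 * l - 1, 2 * l - 2} \<le> 4" by (simp add: card_insert_if)
  ultimately show ?thesis
    using assms by (simp add: card_parity_cut_gen_petersen even_half_labelling del: half_labelling.simps)
qed

theorem theorem4p9:
  fixes l :: nat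
  assumes "4 \<le> l"
  shows "rna_number (gen_petersen (2 * l) 2) = 6"
proof (rule antisym)
  let ?G = "gen_petersen (2 * l) 2"
  have simple: "simple_graph ?G"
    using assms by (intro simple_graph_gen_petersen) auto
  have "rna_number ?G \<le> card (parity_cut ?G (half_labelling l))"
    using simple half_labelling_in_labellings by (rule rna_number_attained(2))
  also have "\<dots> \<le> 6" using assms by (rule card_parity_cut_half_labelling)
  finally show "rna_number ?G \<le> 6" .
  obtain f where f: "f \<in> labellings ?G" "rna_number ?G = card (parity_cut ?G f)"
    using rna_number_attained(1)[OF simple] by blast
  show "6 \<le> rna_number ?G"
    using balanced_colouring_cut_ge_6[OF assms refl labelling_balanced[OF f(1)]] f(2) assms
    by (simp add: card_parity_cut_gen_petersen)
qed

end
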